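(* Let $N,p\ge 1$ and let $\mu(dq)=\pi(q)\,dq$ be a probability measure on $\mathbb{R}^N$ with density $\pi:\mathbb{R}^N\to[0,\infty)$ satisfying $\pi(q)>0$ for Lebesgue-a.e. $q\in\mathbb{R}^N$. Let $r:\mathbb{R}^N\to[0,\infty)$ be any probability density, and define the Markov kernels $$Q(q,d\tilde q)=r(q-\tilde q)\,d\tilde q,\qquad \overline{Q}(q,d\tilde q)=r(\tilde q-q)\,d\tilde q$$ on $\mathbb{R}^N$, and the Markov kernel from $\mathbb{R}^N$ to $(\mathbb{R}^N)^p$ $$\mathcal{V}(q_0,dq_1,\dots,dq_p)=\int_{\mathbb{R}^N}\prod_{i=1}^pQ(q,dq_i)\,\overline{Q}(q_0,dq).$$ For $j=0,\dots,p$ let $$\alpha_j(q_0,q_1,\dots,q_p)=\frac{\pi(q_j)}{\sum_{l=0}^p\pi(q_l)}$$ wherever the denominator is strictly positive, and $\alpha_j=0$ otherwise. Then the Markov kernel $$P(q_0,d\tilde q)=\sum_{j=0}^p\int_{(\mathbb{R}^N)^p}\alpha_j(q_0,q_1,\dots,q_p)\,\delta_{q_j}(d\tilde q)\,\mathcal{V}(q_0,dq_1,\dots,dq_p)$$ satisfies detailed balance with respect to $\mu$, i.e. $P(q,d\tilde q)\,\mu(dq)=P(\tilde q,dq)\,\mu(d\tilde q)$ as measures on $\mathbb{R}^N\times\mathbb{R}^N$.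
   Context: All spaces carry their Borel $\sigma$-algebras; $dq$ denotes Lebesgue measure. No symmetry of $r$ is assumed. *)

theory Defs
  imports "HOL-Probability.Probability"
begin

definition prop_Q :: "('a::euclidean_space \<Rightarrow> real) \<Rightarrow> 'a \<Rightarrow> 'a measure" where
  "prop_Q r q = density lborel (\<lambda>q'. ennreal (r (q - q')))"

definition prop_Qbar :: "('a::euclidean_space \<Rightarrow> real) \<Rightarrow> 'a \<Rightarrow> 'a measure" where
  "prop_Qbar r q = density lborel (\<lambda>q'. ennreal (r (q' - q)))"

lemma prop_Q_kernel:
  fixes r :: "'a::euclidean_space \<Rightarrow> real"
  assumes r [measurable]: "r \<in> borel_measurable borel"
    and pr: "prob_space (density lborel (\<lambda>x. ennreal (r x)))"
  shows "prop_Q r \<in> borel \<rightarrow>\<^sub>M prob_algebra borel"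
proof (rule measurable_prob_algebraI)
  have mass: "(\<integral>\<^sup>+ x. ennreal (r x) \<partial>lborel) = 1"
    using prob_space.emeasure_space_1[OF pr] by (simp add: emeasure_density)
  have ps: "prob_space (prop_Q r q)" for q
  proof (rule prob_spaceI)
    have "(\<integral>\<^sup>+ x. ennreal (r x) \<partial>lborel)
        = (\<integral>\<^sup>+ x. ennreal (r x) \<partial>(density (distr lborel borel (\<lambda>x. q + (-1) *\<^sub>R x)) (\<lambda>_. \<bar>-1::real\<bar> ^ DIM('a))))"
      by (subst lborel_affine[of "-1" q]) simp_all
    also have "\<dots> = (\<integral>\<^sup>+ x. ennreal (r (q - x)) \<partial>lborel)"
      by (simp add: density_1 nn_integral_distr)
    finally show "emeasure (prop_Q r q) (space (prop_Q r q)) = 1"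
      using mass by (simp add: prop_Q_def emeasure_density)
  qed
  show "prob_space (prop_Q r q)" for q by (rule ps)
  show "prop_Q r \<in> borel \<rightarrow>\<^sub>M subprob_algebra borel"
  proof (rule measurable_subprob_algebra)
    fix A :: "'a set" assume [measurable]: "A \<in> sets borel"
    have "(\<lambda>q. \<integral>\<^sup>+ x. ennreal (r (q - x)) * indicator A x \<partial>lborel) \<in> borel_measurable borel"
      by measurable
    then show "(\<lambda>q. emeasure (prop_Q r q) A) \<in> borel_measurable borel"
      by (simp add: prop_Q_def emeasure_density)
  qed (auto simp: prop_Q_def[of r] intro!: prob_space_imp_subprob_space ps[unfolded prop_Q_def])
qed

lemma prop_Qbar_kernel:
  fixes r :: "'a::euclidean_space \<Rightarrow> real"
  assumes r [measurable]: "r \<in> borel_measurable borel"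
    and pr: "prob_space (density lborel (\<lambda>x. ennreal (r x)))"
  shows "prop_Qbar r \<in> borel \<rightarrow>\<^sub>M prob_algebra borel"
proof (rule measurable_prob_algebraI)
  have mass: "(\<integral>\<^sup>+ x. ennreal (r x) \<partial>lborel) = 1"
    using prob_space.emeasure_space_1[OF pr] by (simp add: emeasure_density)
  have ps: "prob_space (prop_Qbar r q)" for q
  proof (rule prob_spaceI)
    have "(\<integral>\<^sup>+ x. ennreal (r x) \<partial>lborel)
        = (\<integral>\<^sup>+ x. ennreal (r x) \<partial>(density (distr lborel borel (\<lambda>x. (-q) + 1 *\<^sub>R x)) (\<lambda>_. \<bar>1::real\<bar> ^ DIM('a))))"
      by (subst lborel_affine[of 1 "-q"]) simp_all
    also have "\<dots> = (\<integral>\<^sup>+ x. ennreal (r (x - q)) \<partial>lborel)"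
      by (simp add: density_1 nn_integral_distr)
    finally show "emeasure (prop_Qbar r q) (space (prop_Qbar r q)) = 1"
      using mass by (simp add: prop_Qbar_def emeasure_density)
  qed
  show "prob_space (prop_Qbar r q)" for q by (rule ps)
  show "prop_Qbar r \<in> borel \<rightarrow>\<^sub>M subprob_algebra borel"
  proof (rule measurable_subprob_algebra)
    fix A :: "'a set" assume [measurable]: "A \<in> sets borel"
    have "(\<lambda>q. \<integral>\<^sup>+ x. ennreal (r (x - q)) * indicator A x \<partial>lborel) \<in> borel_measurable borel"
      by measurable
    then show "(\<lambda>q. emeasure (prop_Qbar r q) A) \<in> borel_measurable borel"
      by (simp add: prop_Qbar_def emeasure_density)
  qed (auto simp: prop_Qbar_def[of r] intro!: prob_space_imp_subprob_space ps[unfolded prop_Qbar_def])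
qed

text \<open>
  \<open>('a)\<^sup>p\<close> is the product space over the index set \<open>{1..p}\<close>; a point of it is a function
  \<open>qs\<close> that is \<open>undefined\<close> outside \<open>{1..p}\<close>.
\<close>

definition prop_V :: "('a::euclidean_space \<Rightarrow> real) \<Rightarrow> nat \<Rightarrow> 'a \<Rightarrow> (nat \<Rightarrow> 'a) measure" where
  "prop_V r p q0 = prop_Qbar r q0 \<bind> (\<lambda>q. \<Pi>\<^sub>M i\<in>{1..p}. prop_Q r q)"

lemma prop_V_kernel:
  fixes r :: "'a::euclidean_space \<Rightarrow> real"
  assumes r: "r \<in> borel_measurable borel"
    and pr: "prob_space (density lborel (\<lambda>x. ennreal (r x)))"
  shows "prop_V r p \<in> borel \<rightarrow>\<^sub>M prob_algebra (\<Pi>\<^sub>M i\<in>{1..p}. borel)"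
proof -
  note Q = prop_Q_kernel[OF r pr]
  have ps: "prob_space (prop_Q r q)" for q
    using measurable_space[OF Q, of q] by (simp add: space_prob_algebra)
  have sQ: "sets (prop_Q r q) = sets borel" for q
    by (simp add: prop_Q_def)
  have "(\<lambda>q. \<Pi>\<^sub>M i\<in>{1..p}. prop_Q r q) \<in> borel \<rightarrow>\<^sub>M prob_algebra (\<Pi>\<^sub>M i\<in>{1..p}. (borel :: 'a measure))"
  proof (rule measurable_prob_algebra_generated[OF sets_PiM Int_stable_prod_algebra prod_algebra_sets_into_space])
    show "prob_space (\<Pi>\<^sub>M i\<in>{1..p}. prop_Q r q)" for q
      by (intro prob_space_PiM ps)
    show "sets (\<Pi>\<^sub>M i\<in>{1..p}. prop_Q r q) = sets (\<Pi>\<^sub>M i\<in>{1..p}. (borel :: 'a measure))" for q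
      by (intro sets_PiM_cong refl sQ)
    fix A assume "A \<in> prod_algebra {1..p} (\<lambda>_. borel :: 'a measure)"
    then obtain E where A: "A = Pi\<^sub>E {1..p} E" and E: "\<And>i. i \<in> {1..p} \<Longrightarrow> E i \<in> sets borel"
      by (auto simp: prod_algebra_eq_finite Pi_iff)
    have "emeasure (\<Pi>\<^sub>M i\<in>{1..p}. prop_Q r q) A = (\<Prod>i\<in>{1..p}. emeasure (prop_Q r q) (E i))" for q
    proof -
      interpret product_sigma_finite "\<lambda>i::nat. prop_Q r q"
        by (intro product_sigma_finite.intro prob_space_imp_sigma_finite ps)
      show ?thesis
        unfolding A using E by (intro emeasure_PiM) (auto simp: sQ)
    qed
    moreover have "(\<lambda>q. \<Prod>i\<in>{1..p}. emeasure (prop_Q r q) (E i)) \<in> borel_measurable borel"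
      using E by (intro borel_measurable_prod_ennreal measurable_emeasure_kernel[OF measurable_prob_algebraD[OF Q]]) auto
    ultimately show "(\<lambda>q. emeasure (\<Pi>\<^sub>M i\<in>{1..p}. prop_Q r q) A) \<in> borel_measurable borel"
      by simp
  qed
  from measurable_bind_prob_space[OF prop_Qbar_kernel[OF r pr] this]
  show ?thesis
    by (simp add: prop_V_def[abs_def])
qed

definition acc_prob :: "('a \<Rightarrow> real) \<Rightarrow> nat \<Rightarrow> nat \<Rightarrow> (nat \<Rightarrow> 'a) \<Rightarrow> real" where
  "acc_prob \<pi> p j q =
     (if (\<Sum>l\<in>{0..p}. \<pi> (q l)) > 0 then \<pi> (q j) / (\<Sum>l\<in>{0..p}. \<pi> (q l)) else 0)"

text \<open>
  The tuple \<open>(q\<^sub>0, q\<^sub>1, \<dots>, q\<^sub>p)\<close> is \<open>qs(0 := q0)\<close>.  The set function below is countably additive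
  for measurable \<open>\<pi>\<close>, so that \<^const>\<open>measure_of\<close> does not degenerate to the null measure; see
  \<open>emeasure_mtm_kernel\<close>.
\<close>

definition mtm_kernel ::
    "('a::euclidean_space \<Rightarrow> real) \<Rightarrow> ('a \<Rightarrow> real) \<Rightarrow> nat \<Rightarrow> 'a \<Rightarrow> 'a measure" where
  "mtm_kernel \<pi> r p q0 = measure_of UNIV (sets borel)
     (\<lambda>A. \<Sum>j\<in>{0..p}. \<integral>\<^sup>+ qs. ennreal (acc_prob \<pi> p j (qs(0 := q0)))
            * emeasure (return borel ((qs(0 := q0)) j)) A \<partial>prop_V r p q0)"

lemma sets_mtm_kernel: "sets (mtm_kernel \<pi> r p q0) = sets borel"
  using sets.sigma_sets_eq[of borel] by (simp add: mtm_kernel_def)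

lemma emeasure_mtm_kernel:
  fixes \<pi> r :: "'a::euclidean_space \<Rightarrow> real"
  assumes [measurable]: "\<pi> \<in> borel_measurable borel" and A: "A \<in> sets borel"
  shows "emeasure (mtm_kernel \<pi> r p q0) A =
    (\<Sum>j\<in>{0..p}. \<integral>\<^sup>+ qs. ennreal (acc_prob \<pi> p j (qs(0 := q0)))
       * emeasure (return borel ((qs(0 := q0)) j)) A \<partial>prop_V r p q0)" (is "_ = ?F A")
proof -
  have sV [measurable_cong]: "sets (prop_V r p q0) = sets (\<Pi>\<^sub>M i\<in>{1..p}. (borel :: 'a measure))"
    unfolding prop_V_def
    by (rule sets_bind) (auto simp: prop_Q_def prop_Qbar_def intro!: sets_PiM_cong)
  have comp [measurable]: "(\<lambda>qs. (qs(0 := q0)) j) \<in> prop_V r p q0 \<rightarrow>\<^sub>M borel" if "j \<in> {0..p}" for j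
  proof (cases "j = 0")
    case False
    then have "(\<lambda>qs. qs j) \<in> prop_V r p q0 \<rightarrow>\<^sub>M borel"
      using that by (subst measurable_cong_sets[OF sV refl]) auto
    then show ?thesis using False by simp
  qed simp
  have sum_m [measurable]: "(\<lambda>qs. \<Sum>l\<in>{0..p}. \<pi> ((qs(0 := q0)) l)) \<in> borel_measurable (prop_V r p q0)"
    by (intro borel_measurable_sum measurable_compose[OF comp]) auto
  have acc [measurable]: "(\<lambda>qs. acc_prob \<pi> p j (qs(0 := q0))) \<in> borel_measurable (prop_V r p q0)"
    if "j \<in> {0..p}" for j
  proof -
    have [measurable]: "(\<lambda>qs. \<pi> ((qs(0 := q0)) j)) \<in> borel_measurable (prop_V r p q0)"
      by (intro measurable_compose[OF comp[OF that]]) auto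
    show ?thesis
      unfolding acc_prob_def by measurable
  qed
  show ?thesis
  proof (rule emeasure_measure_of)
    show "mtm_kernel \<pi> r p q0 = measure_of UNIV (sets borel) ?F"
      by (rule mtm_kernel_def)
    show "A \<in> sets (mtm_kernel \<pi> r p q0)"
      using A by (simp add: sets_mtm_kernel)
    show "positive (sets (mtm_kernel \<pi> r p q0)) ?F"
      by (simp add: positive_def)
    show "countably_additive (sets (mtm_kernel \<pi> r p q0)) ?F"
      unfolding sets_mtm_kernel
    proof (rule countably_additiveI)
      fix B :: "nat \<Rightarrow> 'a set"
      assume B: "range B \<subseteq> sets borel" "disjoint_family B"
      have Bi [measurable]: "B i \<in> sets borel" for i using B(1) by auto
      have dirac: "emeasure (return borel x) (\<Union> (range B)) = (\<Sum>i. emeasure (return borel x) (B i))" for x :: 'a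
        using B by (intro suminf_emeasure[symmetric]) auto
      have m: "(\<lambda>qs. ennreal (acc_prob \<pi> p j (qs(0 := q0))) * emeasure (return borel ((qs(0 := q0)) j)) (B i))
          \<in> borel_measurable (prop_V r p q0)" if "j \<in> {0..p}" for i j
      proof -
        have "(\<lambda>qs. indicator (B i) ((qs(0 := q0)) j) :: ennreal) \<in> borel_measurable (prop_V r p q0)"
          by (intro measurable_compose[OF comp[OF that]]) auto
        moreover have "(\<lambda>qs. ennreal (acc_prob \<pi> p j (qs(0 := q0)))) \<in> borel_measurable (prop_V r p q0)"
          by (intro measurable_compose[OF acc[OF that]]) auto
        ultimately show ?thesis by (simp add: borel_measurable_times_ennreal del: fun_upd_apply)
      qed
      have "?F (\<Union> (range B)) = (\<Sum>j\<in>{0..p}. \<Sum>i. \<integral>\<^sup>+ qs. ennreal (acc_prob \<pi> p j (qs(0 := q0)))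
          * emeasure (return borel ((qs(0 := q0)) j)) (B i) \<partial>prop_V r p q0)"
        by (intro sum.cong refl)
           (simp only: dirac ennreal_suminf_cmult[symmetric] nn_integral_suminf[OF m])
      also have "\<dots> = (\<Sum>i. ?F (B i))"
        by (intro suminf_sum[symmetric] summableI)
      finally show "(\<Sum>i. ?F (B i)) = ?F (\<Union> (range B))" by simp
    qed
  qed simp
qed

text \<open>
  Markov kernels from \<open>M\<close> to \<open>N\<close> are the measurable maps \<open>M \<rightarrow>\<^sub>M prob_algebra N\<close>.  For such a
  kernel \<open>K\<close>, the two sides below are the measures \<open>K(q, dq') \<mu>(dq)\<close> and \<open>K(q', dq) \<mu>(dq')\<close> on
  pairs \<open>(q, q')\<close>.
\<close>

definition detailed_balance :: "'a measure \<Rightarrow> ('a \<Rightarrow> 'a measure) \<Rightarrow> bool" where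
  "detailed_balance \<mu> K \<longleftrightarrow>
     \<mu> \<bind> (\<lambda>q. K q \<bind> (\<lambda>q'. return (\<mu> \<Otimes>\<^sub>M \<mu>) (q, q'))) =
     \<mu> \<bind> (\<lambda>q'. K q' \<bind> (\<lambda>q. return (\<mu> \<Otimes>\<^sub>M \<mu>) (q, q')))"

end

(*
  Since Qbar(q0,dq) dq0 = Q(q,dq0) dq, under dq0 V(q0,dq1,...,dqp) the points q0, ..., qp are
  conditionally i.i.d. draws from Q(q,.) given q, with q distributed according to Lebesgue measure;
  this joint law is exchangeable.  The weight pi(q0) alpha_j(q0,...,qp) equals
  pi(q0) pi(qj) / (pi(q0) + ... + pi(qp)), which is invariant under exchanging q0 and qj.  Hence each
  summand j of P satisfies detailed balance separately.
  P has total mass 1 from every starting point, even one where pi vanishes: as p >= 1 and the law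
  of q1 is absolutely continuous, pi(q1) > 0 almost surely.
*)
theory Submission
  imports Defs
begin

section \<open>General facts on product kernels, exchangeable coordinates and pair laws\<close>

text \<open>Boxes form an intersection-stable generator of the product sigma-algebra, and the mass
  of a box is a finite product of functions measurable in \<open>x\<close>.\<close>

lemma measurable_PiM_kernel:
  assumes I: "finite I" and K: "K \<in> M \<rightarrow>\<^sub>M prob_algebra N"
  shows "(\<lambda>x. \<Pi>\<^sub>M i\<in>I. K x) \<in> M \<rightarrow>\<^sub>M prob_algebra (\<Pi>\<^sub>M i\<in>I. N)"
proof (rule measurable_prob_algebra_generated[OF sets_PiM Int_stable_prod_algebra prod_algebra_sets_into_space])
  have ps: "prob_space (K x)" and sK: "sets (K x) = sets N" if "x \<in> space M" for x
    using measurable_space[OF K that] by (auto simp: space_prob_algebra)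
  show "prob_space (\<Pi>\<^sub>M i\<in>I. K x)" if "x \<in> space M" for x
    by (intro prob_space_PiM ps that)
  show "sets (\<Pi>\<^sub>M i\<in>I. K x) = sets (\<Pi>\<^sub>M i\<in>I. N)" if "x \<in> space M" for x
    by (intro sets_PiM_cong refl sK that)
  fix A assume "A \<in> prod_algebra I (\<lambda>_. N)"
  then obtain E where A: "A = Pi\<^sub>E I E" and E: "\<And>i. i \<in> I \<Longrightarrow> E i \<in> sets N"
    using I by (auto simp: prod_algebra_eq_finite Pi_iff)
  have "emeasure (\<Pi>\<^sub>M i\<in>I. K x) A = (\<Prod>i\<in>I. emeasure (K x) (E i))" if x: "x \<in> space M" for x
  proof -
    interpret product_sigma_finite "\<lambda>i. K x"
      by (intro product_sigma_finite.intro prob_space_imp_sigma_finite ps x)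
    show ?thesis
      unfolding A using E I by (intro emeasure_PiM) (auto simp: sK[OF x])
  qed
  moreover have "(\<lambda>x. \<Prod>i\<in>I. emeasure (K x) (E i)) \<in> borel_measurable M"
    using E by (intro borel_measurable_prod_ennreal measurable_emeasure_kernel[OF measurable_prob_algebraD[OF K]]) auto
  ultimately show "(\<lambda>x. emeasure (\<Pi>\<^sub>M i\<in>I. K x) A) \<in> borel_measurable M"
    by (simp cong: measurable_cong)
qed

text \<open>All factors are equal, so the product measure is invariant under permuting coordinates.
  The restriction to \<open>I\<close> keeps the permuted point in the product space, whose points
  are \<open>undefined\<close> off \<open>I\<close>.\<close>

lemma nn_integral_PiM_transpose:
  assumes I: "a \<in> I" "b \<in> I" and M: "prob_space M"
    and G: "G \<in> borel_measurable (\<Pi>\<^sub>M i\<in>I. M)"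
  shows "(\<integral>\<^sup>+ x. G x \<partial>(\<Pi>\<^sub>M i\<in>I. M)) =
    (\<integral>\<^sup>+ x. G (\<lambda>i\<in>I. x (Transposition.transpose a b i)) \<partial>(\<Pi>\<^sub>M i\<in>I. M))"
proof -
  let ?t = "Transposition.transpose a b"
  have t: "?t \<in> I \<rightarrow> I" using I by (auto simp: Transposition.transpose_def)
  have m: "(\<lambda>x. \<lambda>i\<in>I. x (?t i)) \<in> (\<Pi>\<^sub>M i\<in>I. M) \<rightarrow>\<^sub>M (\<Pi>\<^sub>M i\<in>I. M)"
    using t by (intro measurable_restrict measurable_component_singleton) auto
  have "distr (\<Pi>\<^sub>M i\<in>I. M) (\<Pi>\<^sub>M i\<in>I. M) (\<lambda>x. \<lambda>i\<in>I. x (?t i)) = (\<Pi>\<^sub>M i\<in>I. M)"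
    using distr_PiM_reindex[of I "\<lambda>_. M" ?t I] M t by simp
  then show ?thesis
    using nn_integral_distr[OF m, of G] G by simp
qed

text \<open>For fixed \<open>q\<close> the inner \<open>bind\<close> is the push-forward of
  \<open>K q\<close> under \<open>f q\<close>. The map \<open>f\<close> is left general so that both
  orderings of the pair in detailed balance are instances.\<close>

lemma emeasure_bind_pair:
  assumes \<mu>: "prob_space \<mu>" and K: "K \<in> \<mu> \<rightarrow>\<^sub>M prob_algebra N"
    and f: "case_prod f \<in> \<mu> \<Otimes>\<^sub>M N \<rightarrow>\<^sub>M R" and X: "X \<in> sets R"
  shows "emeasure (\<mu> \<bind> (\<lambda>q. K q \<bind> (\<lambda>q'. return R (f q q')))) X =
    (\<integral>\<^sup>+ q. emeasure (K q) {q' \<in> space N. f q q' \<in> X} \<partial>\<mu>)"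
proof -
  interpret \<mu>: prob_space \<mu> by fact
  have b: "K q \<bind> (\<lambda>q'. return R (f q q')) = distr (K q) R (f q)"
    and e: "emeasure (distr (K q) R (f q)) X = emeasure (K q) {q' \<in> space N. f q q' \<in> X}"
    if q: "q \<in> space \<mu>" for q
  proof -
    have Kq: "prob_space (K q)" "sets (K q) = sets N"
      using measurable_space[OF K q] by (auto simp: space_prob_algebra)
    have fq: "f q \<in> K q \<rightarrow>\<^sub>M R"
      using measurable_compose[OF measurable_Pair1'[OF q] f] Kq by (simp cong: measurable_cong_sets)
    show "K q \<bind> (\<lambda>q'. return R (f q q')) = distr (K q) R (f q)"
      by (rule bind_return_distr'[OF prob_space.not_empty[OF Kq(1)] fq])
    show "emeasure (distr (K q) R (f q)) X = emeasure (K q) {q' \<in> space N. f q q' \<in> X}"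
      using fq X sets_eq_imp_space_eq[OF Kq(2)]
      by (subst emeasure_distr) (auto intro!: arg_cong[where f="emeasure (K q)"])
  qed
  have m: "(\<lambda>q. distr (K q) R (f q)) \<in> \<mu> \<rightarrow>\<^sub>M subprob_algebra R"
    by (rule measurable_distr2[OF f measurable_prob_algebraD[OF K]])
  have "\<mu> \<bind> (\<lambda>q. K q \<bind> (\<lambda>q'. return R (f q q'))) = \<mu> \<bind> (\<lambda>q. distr (K q) R (f q))"
    using b by (intro bind_cong_simp) (auto simp: simp_implies_def)
  then show ?thesis
    by (simp add: emeasure_bind[OF \<mu>.not_empty m X] e cong: nn_integral_cong)
qed

section \<open>The proposal law and its hidden centre\<close>

locale mtm =
  fixes \<pi> r :: "'a::euclidean_space \<Rightarrow> real" and p :: nat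
  assumes p: "p \<ge> 1"
    and \<pi> [measurable]: "\<pi> \<in> borel_measurable borel"
    and \<pi>_nonneg: "0 \<le> \<pi> q"
    and \<pi>_pos: "AE q in lborel. 0 < \<pi> q"
    and r [measurable]: "r \<in> borel_measurable borel"
    and r_prob: "prob_space (density lborel (\<lambda>x. ennreal (r x)))"
begin

abbreviation Qs :: "nat set \<Rightarrow> 'a \<Rightarrow> (nat \<Rightarrow> 'a) measure" where
  "Qs I q \<equiv> \<Pi>\<^sub>M i\<in>I. prop_Q r q"

abbreviation E :: "nat set \<Rightarrow> (nat \<Rightarrow> 'a) measure" where
  "E I \<equiv> \<Pi>\<^sub>M i\<in>I. borel"

lemma prob_space_Q: "prob_space (prop_Q r q)"
  using measurable_space[OF prop_Q_kernel[OF r r_prob], of q] by (simp add: space_prob_algebra)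

lemma prob_space_V: "prob_space (prop_V r p q)"
  using measurable_space[OF prop_V_kernel[OF r r_prob], of q] by (simp add: space_prob_algebra)

lemma sets_Qs [measurable_cong]: "sets (Qs I q) = sets (E I)"
  by (intro sets_PiM_cong) (auto simp: prop_Q_def)

lemma sets_V [measurable_cong]: "sets (prop_V r p q) = sets (E {1..p})"
  using measurable_space[OF prop_V_kernel[OF r r_prob], of q] by (simp add: space_prob_algebra)

lemma Qs_kernel: "finite I \<Longrightarrow> Qs I \<in> borel \<rightarrow>\<^sub>M prob_algebra (E I)"
  by (rule measurable_PiM_kernel[OF _ prop_Q_kernel[OF r r_prob]])

text \<open>Turns the hidden centre \<open>q\<close> into an explicit Lebesgue variable with weight
  \<open>r (q - q0)\<close>, so that its integration can later be interchanged with that of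
  \<open>q0\<close>.\<close>

lemma nn_integral_V:
  assumes [measurable]: "g \<in> borel_measurable (E {1..p})"
  shows "(\<integral>\<^sup>+ x. g x \<partial>prop_V r p q0) = (\<integral>\<^sup>+ q. ennreal (r (q - q0)) * (\<integral>\<^sup>+ x. g x \<partial>Qs {1..p} q) \<partial>lborel)"
proof -
  have K: "Qs {1..p} \<in> borel \<rightarrow>\<^sub>M subprob_algebra (E {1..p})"
    by (rule measurable_prob_algebraD[OF Qs_kernel]) simp
  have "(\<integral>\<^sup>+ x. g x \<partial>prop_V r p q0) = (\<integral>\<^sup>+ q. \<integral>\<^sup>+ x. g x \<partial>Qs {1..p} q \<partial>prop_Qbar r q0)"
    unfolding prop_V_def
    by (rule nn_integral_bind) (use K assms in \<open>auto simp: prop_Qbar_def cong: measurable_cong_sets\<close>)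
  also have "\<dots> = (\<integral>\<^sup>+ q. ennreal (r (q - q0)) * (\<integral>\<^sup>+ x. g x \<partial>Qs {1..p} q) \<partial>lborel)"
    unfolding prop_Qbar_def
    using measurable_compose[OF K nn_integral_measurable_subprob_algebra[OF assms]]
    by (intro nn_integral_density) auto
  finally show ?thesis .
qed

lemma nn_integral_Q:
  "f \<in> borel_measurable borel \<Longrightarrow> (\<integral>\<^sup>+ x. f x \<partial>prop_Q r q) = (\<integral>\<^sup>+ x. ennreal (r (q - x)) * f x \<partial>lborel)"
  unfolding prop_Q_def by (intro nn_integral_density) auto

lemma AE_Q_pos: "AE x in prop_Q r q. 0 < \<pi> x"
  unfolding prop_Q_def using \<pi>_pos by (subst AE_density) auto

text \<open>Given any centre \<open>q\<close>, the coordinate \<open>x 1\<close> has the absolutely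
  continuous law \<open>prop_Q r q\<close>; averaging over the centre keeps the almost sure
  statement. Index 1 exists because \<open>p \<ge> 1\<close>.\<close>

lemma AE_V_pos: "AE x in prop_V r p q0. 0 < \<pi> (x 1)"
proof -
  have K: "Qs {1..p} \<in> prop_Qbar r q0 \<rightarrow>\<^sub>M subprob_algebra (E {1..p})"
    using measurable_prob_algebraD[OF Qs_kernel[of "{1..p}"]]
    by (simp add: prop_Qbar_def cong: measurable_cong_sets)
  have [measurable]: "(\<lambda>x. x 1) \<in> E {1..p} \<rightarrow>\<^sub>M borel"
    using p by (intro measurable_component_singleton) auto
  have "AE x in Qs {1..p} q. 0 < \<pi> (x 1)" for q
    using p AE_Q_pos by (intro AE_PiM_component prob_space_Q) auto
  moreover have "Measurable.pred (E {1..p}) (\<lambda>x. 0 < \<pi> (x 1))"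
    by measurable
  ultimately show ?thesis
    unfolding prop_V_def by (subst AE_bind[OF K]) auto
qed

section \<open>Acceptance weights and the Markov property of P\<close>

text \<open>Putting \<open>q0\<close> back as coordinate 0 reduces measurability in the pair
  \<open>(q0, x)\<close> to measurability of functions of the whole tuple.\<close>

lemma measurable_cons:
  "(\<lambda>(q0, x). x(0 := q0)) \<in> borel \<Otimes>\<^sub>M E {1..p} \<rightarrow>\<^sub>M E {0..p}"
proof -
  have I: "{0..p} = insert 0 {1..p}" by auto
  have "(\<lambda>(x, q0). x(0 := q0)) \<in> E {1..p} \<Otimes>\<^sub>M borel \<rightarrow>\<^sub>M E {0..p}"
    unfolding I using measurable_add_dim[of 0 "{1..p}" "\<lambda>_. borel"] by simp
  from measurable_compose[OF measurable_Pair[OF measurable_snd measurable_fst] this]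
  show ?thesis by (simp add: case_prod_beta)
qed

lemma measurable_acc_prob:
  assumes j: "j \<in> {0..p}"
  shows "acc_prob \<pi> p j \<in> borel_measurable (E {0..p})"
proof -
  have c [measurable]: "(\<lambda>x. \<pi> (x l)) \<in> borel_measurable (E {0..p})" if "l \<in> {0..p}" for l
    by (rule measurable_compose[OF measurable_component_singleton[OF that] \<pi>])
  have [measurable]: "(\<lambda>x. \<Sum>l\<in>{0..p}. \<pi> (x l)) \<in> borel_measurable (E {0..p})"
    by (intro borel_measurable_sum c)
  show ?thesis
    unfolding acc_prob_def[abs_def] using c[OF j] by measurable
qed

lemma sum_acc_prob: "0 < (\<Sum>l\<in>{0..p}. \<pi> (x l)) \<Longrightarrow> (\<Sum>j\<in>{0..p}. acc_prob \<pi> p j x) = 1"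
  by (simp add: acc_prob_def flip: sum_divide_distrib)

lemma acc_prob_nonneg: "0 \<le> acc_prob \<pi> p j x"
  by (auto simp: acc_prob_def intro!: divide_nonneg_pos \<pi>_nonneg)

text \<open>The Dirac mass at coordinate \<open>j\<close> is an indicator, so the integrand is a
  measurable function of the tuple composed with \<open>measurable_cons\<close>. Joint measurability
  is the right form because \<open>q0\<close> occurs both in the integrand and in the law of
  \<open>x\<close>.\<close>

lemma measurable_mtm_integrand:
  assumes j: "j \<in> {0..p}" and [measurable]: "A \<in> sets borel"
  shows "(\<lambda>(q0, x). ennreal (acc_prob \<pi> p j (x(0 := q0))) * emeasure (return borel ((x(0 := q0)) j)) A)
    \<in> borel_measurable (borel \<Otimes>\<^sub>M E {1..p})"
proof -
  have "(\<lambda>x. ennreal (acc_prob \<pi> p j x) * indicator A (x j)) \<in> borel_measurable (E {0..p})"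
  proof -
    have [measurable]: "(\<lambda>x. x j) \<in> E {0..p} \<rightarrow>\<^sub>M borel"
      using j by (intro measurable_component_singleton)
    note measurable_acc_prob[OF j, measurable]
    show ?thesis by measurable
  qed
  from measurable_compose[OF measurable_cons this] show ?thesis
    by (simp add: case_prod_beta del: fun_upd_apply)
qed

lemma mtm_kernel_measurable: "mtm_kernel \<pi> r p \<in> borel \<rightarrow>\<^sub>M prob_algebra borel"
proof (rule measurable_prob_algebraI)
  show ps: "prob_space (mtm_kernel \<pi> r p q0)" for q0
  proof (rule prob_spaceI)
    interpret V: prob_space "prop_V r p q0" by (rule prob_space_V)
    have sp: "space (mtm_kernel \<pi> r p q0) = UNIV"
      using sets_eq_imp_space_eq[OF sets_mtm_kernel] by simp
    have m: "(\<lambda>x. ennreal (acc_prob \<pi> p j (x(0 := q0)))) \<in> borel_measurable (prop_V r p q0)"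
      if "j \<in> {0..p}" for j
      using measurable_compose[OF measurable_Pair1' measurable_mtm_integrand[OF that, of UNIV], of q0]
      by (simp add: sets_V cong: measurable_cong_sets)
    have "emeasure (mtm_kernel \<pi> r p q0) UNIV =
        (\<Sum>j\<in>{0..p}. \<integral>\<^sup>+ x. ennreal (acc_prob \<pi> p j (x(0 := q0))) \<partial>prop_V r p q0)"
      by (simp add: emeasure_mtm_kernel[OF \<pi>] del: fun_upd_apply)
    also have "\<dots> = (\<integral>\<^sup>+ x. (\<Sum>j\<in>{0..p}. ennreal (acc_prob \<pi> p j (x(0 := q0)))) \<partial>prop_V r p q0)"
      by (rule nn_integral_sum[symmetric]) (rule m)
    \<comment> \<open>Almost surely \<open>\<pi> (x 1)\<close> is positive, and it is one of the
      summands of the denominator. The default value 0 of \<open>acc_prob\<close> is therefore met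
      only on a null set, and no mass is lost.\<close>
    also have "\<dots> = (\<integral>\<^sup>+ x. 1 \<partial>prop_V r p q0)"
    proof (rule nn_integral_cong_AE, rule AE_mp[OF AE_V_pos], rule AE_I2, rule impI)
      fix x :: "nat \<Rightarrow> 'a" assume "0 < \<pi> (x 1)"
      then have "0 < (\<Sum>l\<in>{0..p}. \<pi> ((x(0 := q0)) l))"
        using p by (intro sum_pos2[of _ 1] \<pi>_nonneg) auto
      from sum_acc_prob[of "x(0 := q0)", OF this] show "(\<Sum>j\<in>{0..p}. ennreal (acc_prob \<pi> p j (x(0 := q0)))) = 1"
        by (subst sum_ennreal) (simp_all add: acc_prob_nonneg del: fun_upd_apply)
    qed
    also have "\<dots> = 1"
      by (simp add: V.emeasure_space_1)
    finally show "emeasure (mtm_kernel \<pi> r p q0) (space (mtm_kernel \<pi> r p q0)) = 1"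
      by (simp add: sp)
  qed
  show "mtm_kernel \<pi> r p \<in> borel \<rightarrow>\<^sub>M subprob_algebra borel"
  proof (rule measurable_subprob_algebra)
    fix A :: "'a set" assume A: "A \<in> sets borel"
    have "(\<lambda>q0. \<integral>\<^sup>+ x. ennreal (acc_prob \<pi> p j (x(0 := q0)))
        * emeasure (return borel ((x(0 := q0)) j)) A \<partial>prop_V r p q0) \<in> borel_measurable borel"
      if j: "j \<in> {0..p}" for j
      by (rule nn_integral_measurable_subprob_algebra2
          [OF measurable_mtm_integrand[OF j A] measurable_prob_algebraD[OF prop_V_kernel[OF r r_prob]]])
    then show "(\<lambda>q0. emeasure (mtm_kernel \<pi> r p q0) A) \<in> borel_measurable borel"
      unfolding emeasure_mtm_kernel[OF \<pi> A] by (rule borel_measurable_sum)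
  qed (auto simp: sets_mtm_kernel intro: prob_space_imp_subprob_space ps)
qed

section \<open>Joint law of the tuple under Lebesgue start\<close>

text \<open>The number \<open>r (q - q0)\<close> is both the density of
  \<open>prop_Qbar r q0\<close> at \<open>q\<close> and the density of \<open>prop_Q r q\<close> at
  \<open>q0\<close>. Interchanging the two Lebesgue integrals passes from the first reading to the
  second and makes \<open>q0\<close> one more independent draw around the centre
  \<open>q\<close>.\<close>

lemma nn_integral_V_joint:
  assumes G: "G \<in> borel_measurable (E {0..p})"
  shows "(\<integral>\<^sup>+ q0. \<integral>\<^sup>+ x. G (x(0 := q0)) \<partial>prop_V r p q0 \<partial>lborel) =
    (\<integral>\<^sup>+ q. \<integral>\<^sup>+ x. G x \<partial>Qs {0..p} q \<partial>lborel)"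
proof -
  have Gm: "(\<lambda>(q0, x). G (x(0 := q0))) \<in> borel_measurable (borel \<Otimes>\<^sub>M E {1..p})"
    using measurable_compose[OF measurable_cons G] by (simp add: case_prod_beta)
  have Gs: "(\<lambda>x. G (x(0 := q0))) \<in> borel_measurable (E {1..p})" for q0
    using measurable_compose[OF measurable_Pair1' Gm, of q0] by simp
  \<comment> \<open>Joint measurability in \<open>(q0, q)\<close> is used for the interchange of
    integrals and, through its sections, for absorbing the density.\<close>
  have J: "(\<lambda>(q0, q). \<integral>\<^sup>+ x. G (x(0 := q0)) \<partial>Qs {1..p} q) \<in> borel_measurable (borel \<Otimes>\<^sub>M borel)"
  proof -
    have "(\<lambda>z. \<integral>\<^sup>+ x. G (x(0 := fst z)) \<partial>Qs {1..p} (snd z)) \<in> borel_measurable (borel \<Otimes>\<^sub>M borel)"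
    proof (rule nn_integral_measurable_subprob_algebra2)
      show "(\<lambda>z. Qs {1..p} (snd z)) \<in> borel \<Otimes>\<^sub>M borel \<rightarrow>\<^sub>M subprob_algebra (E {1..p})"
        by (rule measurable_compose[OF measurable_snd measurable_prob_algebraD[OF Qs_kernel]]) simp
      have "(\<lambda>z. (fst (fst z), snd z)) \<in>
          ((borel :: 'a measure) \<Otimes>\<^sub>M (borel :: 'a measure)) \<Otimes>\<^sub>M E {1..p} \<rightarrow>\<^sub>M borel \<Otimes>\<^sub>M E {1..p}"
        by measurable
      from measurable_compose[OF this Gm]
      show "(\<lambda>(z, x). G (x(0 := fst z))) \<in> borel_measurable (((borel :: 'a measure) \<Otimes>\<^sub>M (borel :: 'a measure)) \<Otimes>\<^sub>M E {1..p})"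
        by (simp add: case_prod_unfold)
    qed
    then show ?thesis by (simp add: case_prod_beta)
  qed
  note J' = measurable_compose[OF _ J, unfolded case_prod_beta]
  have I: "{0..p} = insert 0 {1..p}" by auto
  have "(\<integral>\<^sup>+ q0. \<integral>\<^sup>+ x. G (x(0 := q0)) \<partial>prop_V r p q0 \<partial>lborel) =
      (\<integral>\<^sup>+ q0. \<integral>\<^sup>+ q. ennreal (r (q - q0)) * (\<integral>\<^sup>+ x. G (x(0 := q0)) \<partial>Qs {1..p} q) \<partial>lborel \<partial>lborel)"
    by (simp add: nn_integral_V[OF Gs])
  also have "\<dots> = (\<integral>\<^sup>+ q. \<integral>\<^sup>+ q0. ennreal (r (q - q0)) * (\<integral>\<^sup>+ x. G (x(0 := q0)) \<partial>Qs {1..p} q) \<partial>lborel \<partial>lborel)"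
  proof (rule lborel_pair.Fubini')
    have "(\<lambda>z. ennreal (r (fst z - snd z)) * (\<integral>\<^sup>+ x. G (x(0 := snd z)) \<partial>Qs {1..p} (fst z)))
        \<in> borel_measurable (borel \<Otimes>\<^sub>M borel)"
      using J'[OF measurable_Pair[OF measurable_snd measurable_fst]] by simp
    then show "(\<lambda>(q, q0). ennreal (r (q - q0)) * (\<integral>\<^sup>+ x. G (x(0 := q0)) \<partial>Qs {1..p} q))
        \<in> borel_measurable (lborel \<Otimes>\<^sub>M lborel)"
      by (simp add: case_prod_beta cong: measurable_cong_sets)
  qed
  \<comment> \<open>Now \<open>q\<close> is fixed outside, and \<open>r (q - q0)\<close> is read as
    a density in \<open>q0\<close>.\<close>
  also have "\<dots> = (\<integral>\<^sup>+ q. \<integral>\<^sup>+ q0. \<integral>\<^sup>+ x. G (x(0 := q0)) \<partial>Qs {1..p} q \<partial>prop_Q r q \<partial>lborel)"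
  proof (rule nn_integral_cong)
    fix q
    have "(\<lambda>q0. \<integral>\<^sup>+ x. G (x(0 := q0)) \<partial>Qs {1..p} q) \<in> borel_measurable lborel"
      using J'[of "\<lambda>q0. (q0, q)" borel] by simp
    then show "(\<integral>\<^sup>+ q0. ennreal (r (q - q0)) * (\<integral>\<^sup>+ x. G (x(0 := q0)) \<partial>Qs {1..p} q) \<partial>lborel) =
        (\<integral>\<^sup>+ q0. \<integral>\<^sup>+ x. G (x(0 := q0)) \<partial>Qs {1..p} q \<partial>prop_Q r q)"
      by (subst nn_integral_Q) auto
  qed
  \<comment> \<open>The outer draw \<open>q0\<close> has the same law as the other coordinates, so
    it becomes coordinate 0 of a product over \<open>{0..p}\<close>.\<close>
  also have "\<dots> = (\<integral>\<^sup>+ q. \<integral>\<^sup>+ x. G x \<partial>Qs {0..p} q \<partial>lborel)"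
  proof (rule nn_integral_cong)
    fix q
    interpret product_sigma_finite "\<lambda>i::nat. prop_Q r q"
      by (intro product_sigma_finite.intro prob_space_imp_sigma_finite prob_space_Q)
    have "G \<in> borel_measurable (Qs (insert 0 {1..p}) q)"
      using G unfolding I by (simp add: sets_Qs cong: measurable_cong_sets)
    then show "(\<integral>\<^sup>+ q0. \<integral>\<^sup>+ x. G (x(0 := q0)) \<partial>Qs {1..p} q \<partial>prop_Q r q) = (\<integral>\<^sup>+ x. G x \<partial>Qs {0..p} q)"
      unfolding I by (subst product_nn_integral_insert_rev) auto
  qed
  finally show ?thesis .
qed

section \<open>Exchange symmetry and mass flow\<close>

text \<open>The denominator sums over the whole tuple, so relabelling changes neither it nor the
  case where the default 0 applies; the numerator \<open>\<pi> (x 0) * \<pi> (x j)\<close> is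
  symmetric.\<close>

lemma acc_prob_transpose:
  assumes j: "j \<in> {0..p}"
  shows "\<pi> ((\<lambda>i\<in>{0..p}. x (Transposition.transpose 0 j i)) 0) *
      acc_prob \<pi> p j (\<lambda>i\<in>{0..p}. x (Transposition.transpose 0 j i)) = \<pi> (x 0) * acc_prob \<pi> p j x"
proof -
  have "(\<Sum>l\<in>{0..p}. \<pi> (x (Transposition.transpose 0 j l))) = (\<Sum>l\<in>{0..p}. \<pi> (x l))"
    using j by (intro sum.reindex_bij_betw permutes_imp_bij permutes_swap_id) auto
  then show ?thesis
    using j by (simp add: acc_prob_def)
qed

text \<open>The mass that the \<open>j\<close>-th summand of P gives to pairs (start, next point) in
  \<open>X\<close> when the start has law \<mu>. It is written through the symmetric joint law, so
  that coordinates 0 and \<open>j\<close> stand on the same footing.\<close>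

definition flow :: "nat \<Rightarrow> ('a \<times> 'a) set \<Rightarrow> ennreal" where
  "flow j X = (\<integral>\<^sup>+ q. \<integral>\<^sup>+ x. ennreal (\<pi> (x 0) * acc_prob \<pi> p j x) * indicator X (x 0, x j) \<partial>Qs {0..p} q \<partial>lborel)"

lemma measurable_flow:
  assumes j: "j \<in> {0..p}" and X [measurable]: "X \<in> sets (borel \<Otimes>\<^sub>M borel)"
  shows "(\<lambda>x. ennreal (\<pi> (x 0) * acc_prob \<pi> p j x) * indicator X (x 0, x j)) \<in> borel_measurable (E {0..p})"
proof -
  have [measurable]: "(\<lambda>x. x j) \<in> E {0..p} \<rightarrow>\<^sub>M borel" "(\<lambda>x. x 0) \<in> E {0..p} \<rightarrow>\<^sub>M borel"
    using j by (auto intro!: measurable_component_singleton)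
  note measurable_acc_prob[OF j, measurable]
  show ?thesis by measurable
qed

text \<open>Transposing 0 and \<open>j\<close> reverses the pair \<open>(x 0, x j)\<close> but
  preserves the weight and the product measure. The identity thus holds for each centre
  \<open>q\<close> separately, before integrating over it.\<close>

lemma flow_swap:
  assumes j: "j \<in> {0..p}" and X: "X \<in> sets (borel \<Otimes>\<^sub>M borel)"
  shows "flow j X = flow j (prod.swap -` X)"
  unfolding flow_def
proof (rule nn_integral_cong)
  fix q
  let ?g = "\<lambda>X x. ennreal (\<pi> (x 0) * acc_prob \<pi> p j x) * indicator X (x 0, x j)"
  have m: "?g X \<in> borel_measurable (Qs {0..p} q)"
    using measurable_flow[OF j X] by (simp add: sets_Qs cong: measurable_cong_sets)
  have "?g X (\<lambda>i\<in>{0..p}. x (Transposition.transpose 0 j i)) = ?g (prod.swap -` X) x" for x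
    unfolding acc_prob_transpose[OF j] using j by (simp add: indicator_def)
  then show "(\<integral>\<^sup>+ x. ?g X x \<partial>Qs {0..p} q) = (\<integral>\<^sup>+ x. ?g (prod.swap -` X) x \<partial>Qs {0..p} q)"
    using nn_integral_PiM_transpose[OF _ j prob_space_Q m, of 0] by simp
qed

text \<open>The factor \<open>\<pi> q0\<close> moves inside the integral, the Dirac mass turns into
  the indicator of \<open>X\<close> at the pair of coordinates 0 and \<open>j\<close>, and
  \<open>nn_integral_V_joint\<close> then applies to each summand.\<close>

lemma nn_integral_mtm_kernel_eq_flow:
  assumes X [measurable]: "X \<in> sets (borel \<Otimes>\<^sub>M borel)"
  shows "(\<integral>\<^sup>+ q0. emeasure (mtm_kernel \<pi> r p q0) {q. (q0, q) \<in> X} \<partial>density lborel (\<lambda>q. ennreal (\<pi> q))) =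
    (\<Sum>j\<in>{0..p}. flow j X)"
proof -
  have A [measurable]: "{q. (q0, q) \<in> X} \<in> sets borel" for q0
    using sets_Pair1[OF X, of q0] by (simp add: vimage_def)
  let ?g = "\<lambda>j x. ennreal (\<pi> (x 0) * acc_prob \<pi> p j x) * indicator X (x 0, x j)"
  have gc: "(\<lambda>(q0, x). ?g j (x(0 := q0))) \<in> borel_measurable (borel \<Otimes>\<^sub>M E {1..p})"
    if "j \<in> {0..p}" for j
    using measurable_compose[OF measurable_cons measurable_flow[OF that X]]
    by (simp add: case_prod_beta del: fun_upd_apply)
  have step: "ennreal (\<pi> q0) * emeasure (mtm_kernel \<pi> r p q0) {q. (q0, q) \<in> X} =
      (\<Sum>j\<in>{0..p}. \<integral>\<^sup>+ x. ?g j (x(0 := q0)) \<partial>prop_V r p q0)" for q0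
  proof -
    have "ennreal (\<pi> q0) * (\<integral>\<^sup>+ x. ennreal (acc_prob \<pi> p j (x(0 := q0)))
        * emeasure (return borel ((x(0 := q0)) j)) {q. (q0, q) \<in> X} \<partial>prop_V r p q0) =
      (\<integral>\<^sup>+ x. ?g j (x(0 := q0)) \<partial>prop_V r p q0)" if j: "j \<in> {0..p}" for j
    proof -
      have m: "(\<lambda>x. ennreal (acc_prob \<pi> p j (x(0 := q0)))
        * emeasure (return borel ((x(0 := q0)) j)) {q. (q0, q) \<in> X}) \<in> borel_measurable (prop_V r p q0)"
        using measurable_compose[OF measurable_Pair1' measurable_mtm_integrand[OF j A], of q0]
        by (simp add: sets_V cong: measurable_cong_sets del: fun_upd_apply)
      show ?thesis
        by (subst nn_integral_cmult[OF m, symmetric], rule nn_integral_cong)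
           (auto simp: ennreal_mult \<pi>_nonneg acc_prob_nonneg indicator_def mult_ac)
    qed
    then show ?thesis
      by (simp add: emeasure_mtm_kernel[OF \<pi> A] sum_distrib_left del: fun_upd_apply)
  qed
  \<comment> \<open>Trading the density for the factor \<open>\<pi>\<close> needs a measurable
    integrand; the kernel property of P gives this for the sections of \<open>X\<close>.\<close>
  have "(\<lambda>z. emeasure (mtm_kernel \<pi> r p z) {q. (z, q) \<in> X}) \<in> borel_measurable borel"
  proof (rule emeasure_measurable_subprob_algebra2[OF _ measurable_prob_algebraD[OF mtm_kernel_measurable]])
    have "(SIGMA q:space borel. {q'. (q, q') \<in> X}) = X" by auto
    then show "(SIGMA q:space borel. {q'. (q, q') \<in> X}) \<in> sets (borel \<Otimes>\<^sub>M borel)"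
      using X by simp
  qed
  then have "(\<integral>\<^sup>+ q0. emeasure (mtm_kernel \<pi> r p q0) {q. (q0, q) \<in> X} \<partial>density lborel (\<lambda>q. ennreal (\<pi> q))) =
      (\<integral>\<^sup>+ q0. (\<Sum>j\<in>{0..p}. \<integral>\<^sup>+ x. ?g j (x(0 := q0)) \<partial>prop_V r p q0) \<partial>lborel)"
    by (subst nn_integral_density) (auto simp: step simp del: fun_upd_apply)
  also have "\<dots> = (\<Sum>j\<in>{0..p}. \<integral>\<^sup>+ q0. \<integral>\<^sup>+ x. ?g j (x(0 := q0)) \<partial>prop_V r p q0 \<partial>lborel)"
  proof (rule nn_integral_sum)
    fix j assume j: "j \<in> {0..p}"
    show "(\<lambda>q0. \<integral>\<^sup>+ x. ?g j (x(0 := q0)) \<partial>prop_V r p q0) \<in> borel_measurable lborel"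
      using nn_integral_measurable_subprob_algebra2
          [OF gc[OF j] measurable_prob_algebraD[OF prop_V_kernel[OF r r_prob]]]
      by (simp cong: measurable_cong_sets del: fun_upd_apply)
  qed
  also have "\<dots> = (\<Sum>j\<in>{0..p}. flow j X)"
    unfolding flow_def by (intro sum.cong refl nn_integral_V_joint measurable_flow X)
  finally show ?thesis .
qed

end

section \<open>Detailed balance from the symmetry of the flows\<close>

theorem mainTheorem9:
  fixes \<pi> r :: "real ^ 'n \<Rightarrow> real"
    and \<mu> :: "(real ^ 'n) measure"
    and p :: nat
  assumes "p \<ge> 1"
    and "\<pi> \<in> borel_measurable borel"
    and "\<And>q. 0 \<le> \<pi> q"
    and "AE q in lborel. 0 < \<pi> q"
    and "\<mu> = density lborel (\<lambda>q. ennreal (\<pi> q))"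
    and "prob_space \<mu>"
    and "r \<in> borel_measurable borel"
    and "\<And>x. 0 \<le> r x"
    and "prob_space (density lborel (\<lambda>x. ennreal (r x)))"
  shows "mtm_kernel \<pi> r p \<in> borel \<rightarrow>\<^sub>M prob_algebra borel
       \<and> detailed_balance \<mu> (mtm_kernel \<pi> r p)"
proof
  interpret mtm \<pi> r p
    by (rule mtm.intro) (rule assms)+
  let ?K = "mtm_kernel \<pi> r p"
  show K: "?K \<in> borel \<rightarrow>\<^sub>M prob_algebra borel"
    by (rule mtm_kernel_measurable)
  have s [measurable_cong]: "sets \<mu> = sets borel" and sp: "space \<mu> = UNIV"
    by (auto simp: assms(5))
  have s2: "sets (\<mu> \<Otimes>\<^sub>M \<mu>) = sets (borel \<Otimes>\<^sub>M borel)"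
    by (rule sets_pair_measure_cong[OF s s])
  have K\<mu>: "?K \<in> \<mu> \<rightarrow>\<^sub>M prob_algebra borel"
    using K by (simp add: s cong: measurable_cong_sets)
  let ?L = "\<mu> \<bind> (\<lambda>q. ?K q \<bind> (\<lambda>q'. return (\<mu> \<Otimes>\<^sub>M \<mu>) (q, q')))"
  let ?R = "\<mu> \<bind> (\<lambda>q'. ?K q' \<bind> (\<lambda>q. return (\<mu> \<Otimes>\<^sub>M \<mu>) (q, q')))"
  \<comment> \<open>\<open>sets_bind\<close> asks for nonempty spaces, and all spaces involved are
    the whole of \<open>real ^ 'n\<close>. A general \<open>f\<close> covers both orderings of the
    pair.\<close>
  have sets: "sets (\<mu> \<bind> (\<lambda>q. ?K q \<bind> (\<lambda>q'. return (\<mu> \<Otimes>\<^sub>M \<mu>) (f q q')))) = sets (\<mu> \<Otimes>\<^sub>M \<mu>)" for f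
    by (subst sets_bind[of _ _ "\<mu> \<Otimes>\<^sub>M \<mu>"])
       (auto simp: sp sets_eq_imp_space_eq[OF sets_mtm_kernel] intro!: sets_bind)
  have "?L = ?R"
  proof (rule measure_eqI)
    show "sets ?L = sets ?R"
      by (simp only: sets)
    fix X assume "X \<in> sets ?L"
    then have X\<mu>: "X \<in> sets (\<mu> \<Otimes>\<^sub>M \<mu>)"
      by (simp only: sets)
    then have X: "X \<in> sets (borel \<Otimes>\<^sub>M borel)"
      by (simp only: s2)
    have "prod.swap -` X \<inter> space (borel \<Otimes>\<^sub>M borel) \<in> sets (borel \<Otimes>\<^sub>M borel)"
      by (rule measurable_sets[OF _ X]) (unfold prod.swap_def[abs_def], measurable)
    then have X': "prod.swap -` X \<in> sets (borel \<Otimes>\<^sub>M borel)"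
      by (simp add: space_pair_measure)
    have f: "case_prod Pair \<in> \<mu> \<Otimes>\<^sub>M borel \<rightarrow>\<^sub>M \<mu> \<Otimes>\<^sub>M \<mu>"
      "case_prod (\<lambda>q' q. (q, q')) \<in> \<mu> \<Otimes>\<^sub>M borel \<rightarrow>\<^sub>M \<mu> \<Otimes>\<^sub>M \<mu>"
      unfolding case_prod_unfold
      by (subst measurable_cong_sets[OF sets_pair_measure_cong[OF s refl] s2]; measurable)+
    have "emeasure ?L X = (\<Sum>j\<in>{0..p}. flow j X)"
      using emeasure_bind_pair[OF assms(6) K\<mu> f(1) X\<mu>] nn_integral_mtm_kernel_eq_flow[OF X]
      by (simp add: assms(5))
    also have "\<dots> = (\<Sum>j\<in>{0..p}. flow j (prod.swap -` X))"
      by (intro sum.cong refl flow_swap X)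
    \<comment> \<open>In \<open>?R\<close> the starting point is the second coordinate, so the
      relevant sections of \<open>X\<close> are the ordinary sections of its preimage under
      \<open>prod.swap\<close>.\<close>
    also have "\<dots> = emeasure ?R X"
      using emeasure_bind_pair[OF assms(6) K\<mu> f(2) X\<mu>] nn_integral_mtm_kernel_eq_flow[OF X']
      by (simp add: assms(5))
    finally show "emeasure ?L X = emeasure ?R X" .
  qed
  then show "detailed_balance \<mu> ?K"
    by (simp add: detailed_balance_def)
qed

end
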